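(* Let $\mathcal{A}$ be a $\mathbf{tDL}$-algebra with associated tense Priestley space $(X(A),R_A)$. Then $\mathcal{A}$ is subdirectly irreducible if and only if there is $Z\in C_t(X(A))\setminus\{X(A)\}$ such that $Y\subseteq Z$ for every $Y\in C_t(X(A))\setminus\{X(A)\}$.
   Context: A $\mathbf{tDL}$-algebra is a bounded distributive lattice $\langle A,\wedge,\vee,0,1\rangle$ with unary operators $\mathbf{G},\mathbf{H},\mathbf{F},\mathbf{P}$ such that for all $x,y$: $\mathbf{G}1=\mathbf{H}1=1$; $\mathbf{G},\mathbf{H}$ preserve $\wedge$; $x\le\mathbf{G}\mathbf{P}x$, $x\le\mathbf{H}\mathbf{F}x$; $\mathbf{G}(x\vee y)\le\mathbf{G}x\vee\mathbf{F}y$, $\mathbf{H}(x\vee y)\le\mathbf{H}x\vee\mathbf{P}y$; $\mathbf{F}0=\mathbf{P}0=0$; $\mathbf{F},\mathbf{P}$ preserve $\vee$; $\mathbf{P}\mathbf{G}x\le x$, $\mathbf{F}\mathbf{H}x\le x$; $\mathbf{G}x\wedge\mathbf{F}y\le\mathbf{F}(x\wedge y)$, $\mathbf{H}x\wedge\mathbf{P}y\le\mathbf{P}(x\wedge y)$. Subdirect irreducibility refers to this algebra's congruences. $X(A)$ is the set of prime filters ordered by inclusion with the Priestley topology generated by the sets $\sigma_A(a)=\{T\in X(A):a\in T\}$ and their complements; $(S,T)\in R_A$ iff $\{a:\mathbf{G}a\in S\}\subseteq T\subseteq\{a:\mathbf{F}a\in S\}$. With $R_A(x)=\{y:(x,y)\in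 R_A\}$, $R_A^{-1}(x)=\{y:(y,x)\in R_A\}$, a subset $Y\subseteq X(A)$ is a $\mathbf{tPS}$-set if for all $x,y$: (tc1) if $x\in R_A^{-1}(y)\cap Y$ then there are $w_1,w_2\in R_A(x)\cap Y$ with $w_1\subseteq y\subseteq w_2$; (tc2) if $x\in R_A(y)\cap Y$ then there are $w_1,w_2\in R_A^{-1}(x)\cap Y$ with $w_1\subseteq y\subseteq w_2$. $C_t(X(A))$ is the set of closed $\mathbf{tPS}$-sets. *)

theory Defs
  imports "HOL-Analysis.Function_Topology"
begin

unbundle lattice_syntax

text \<open>The sort does not force \<open>\<bottom> \<noteq> \<top>\<close>, so the one-element algebra is included.\<close>

locale tDL_algebra =
  fixes G H F P :: "'a::{distrib_lattice,bounded_lattice} \<Rightarrow> 'a"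
  assumes G_top: "G \<top> = \<top>" and H_top: "H \<top> = \<top>"
    and G_inf: "G (x \<sqinter> y) = G x \<sqinter> G y" and H_inf: "H (x \<sqinter> y) = H x \<sqinter> H y"
    and le_G_P: "x \<le> G (P x)" and le_H_F: "x \<le> H (F x)"
    and G_sup_le: "G (x \<squnion> y) \<le> G x \<squnion> F y" and H_sup_le: "H (x \<squnion> y) \<le> H x \<squnion> P y"
    and F_bot: "F \<bottom> = \<bottom>" and P_bot: "P \<bottom> = \<bottom>"
    and F_sup: "F (x \<squnion> y) = F x \<squnion> F y" and P_sup: "P (x \<squnion> y) = P x \<squnion> P y"
    and P_G_le: "P (G x) \<le> x" and F_H_le: "F (H x) \<le> x"
    and G_F_le: "G x \<sqinter> F y \<le> F (x \<sqinter> y)" and H_P_le: "H x \<sqinter> P y \<le> P (x \<sqinter> y)"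

definition tDL_congruence ::
  "('a::{distrib_lattice,bounded_lattice} \<Rightarrow> 'a) \<Rightarrow> ('a \<Rightarrow> 'a) \<Rightarrow> ('a \<Rightarrow> 'a) \<Rightarrow> ('a \<Rightarrow> 'a) \<Rightarrow> 'a rel \<Rightarrow> bool"
  where
  "tDL_congruence G H F P \<theta> \<longleftrightarrow>
     equiv UNIV \<theta> \<and>
     (\<forall>a b c d. (a, b) \<in> \<theta> \<longrightarrow> (c, d) \<in> \<theta> \<longrightarrow> (a \<sqinter> c, b \<sqinter> d) \<in> \<theta> \<and> (a \<squnion> c, b \<squnion> d) \<in> \<theta>) \<and>
     (\<forall>a b. (a, b) \<in> \<theta> \<longrightarrow>
        (G a, G b) \<in> \<theta> \<and> (H a, H b) \<in> \<theta> \<and> (F a, F b) \<in> \<theta> \<and> (P a, P b) \<in> \<theta>)"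

text \<open>Existence of a monolith, i.e. a least congruence different from the identity. Under this
  convention the one-element algebra is not subdirectly irreducible.\<close>

definition tDL_subdirectly_irreducible ::
  "('a::{distrib_lattice,bounded_lattice} \<Rightarrow> 'a) \<Rightarrow> ('a \<Rightarrow> 'a) \<Rightarrow> ('a \<Rightarrow> 'a) \<Rightarrow> ('a \<Rightarrow> 'a) \<Rightarrow> bool"
  where
  "tDL_subdirectly_irreducible G H F P \<longleftrightarrow>
     (\<exists>\<mu>. tDL_congruence G H F P \<mu> \<and> \<mu> \<noteq> Id \<and>
          (\<forall>\<theta>. tDL_congruence G H F P \<theta> \<and> \<theta> \<noteq> Id \<longrightarrow> \<mu> \<subseteq> \<theta>))"

definition prime_filter :: "'a::{distrib_lattice,bounded_lattice} set \<Rightarrow> bool" where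
  "prime_filter T \<longleftrightarrow>
     T \<noteq> {} \<and> T \<noteq> UNIV \<and>
     (\<forall>a b. a \<in> T \<longrightarrow> a \<le> b \<longrightarrow> b \<in> T) \<and>
     (\<forall>a b. a \<in> T \<longrightarrow> b \<in> T \<longrightarrow> a \<sqinter> b \<in> T) \<and>
     (\<forall>a b. a \<squnion> b \<in> T \<longrightarrow> a \<in> T \<or> b \<in> T)"

definition prime_filters :: "'a::{distrib_lattice,bounded_lattice} set set" where
  "prime_filters = {T. prime_filter T}"

definition priestley_sigma :: "'a::{distrib_lattice,bounded_lattice} \<Rightarrow> 'a set set" where
  "priestley_sigma a = {T \<in> prime_filters. a \<in> T}"

definition priestley_topology :: "'a::{distrib_lattice,bounded_lattice} set topology" where
  "priestley_topology =
     topology_generated_by (range priestley_sigma \<union> range (\<lambda>a. prime_filters - priestley_sigma a))"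

lemma topspace_priestley_topology: "topspace priestley_topology = prime_filters"
  unfolding priestley_topology_def topology_generated_by_topspace priestley_sigma_def by blast

definition tense_rel ::
  "('a::{distrib_lattice,bounded_lattice} \<Rightarrow> 'a) \<Rightarrow> ('a \<Rightarrow> 'a) \<Rightarrow> 'a set rel" where
  "tense_rel G F =
     {(S, T). S \<in> prime_filters \<and> T \<in> prime_filters \<and> {a. G a \<in> S} \<subseteq> T \<and> T \<subseteq> {a. F a \<in> S}}"

text \<open>Below, \<open>R `` {x}\<close> is \<open>R(x)\<close> and \<open>R\<inverse> `` {x}\<close> is \<open>R\<inverse>(x) = {y. (y, x) \<in> R}\<close>.\<close>

definition tPS_set ::
  "('a::{distrib_lattice,bounded_lattice} \<Rightarrow> 'a) \<Rightarrow> ('a \<Rightarrow> 'a) \<Rightarrow> 'a set set \<Rightarrow> bool" where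
  "tPS_set G F Y \<longleftrightarrow>
     Y \<subseteq> prime_filters \<and>
     (let R = tense_rel G F in
      \<forall>x\<in>prime_filters. \<forall>y\<in>prime_filters.
        (x \<in> R\<inverse> `` {y} \<inter> Y \<longrightarrow>
           (\<exists>w1 \<in> R `` {x} \<inter> Y. \<exists>w2 \<in> R `` {x} \<inter> Y. w1 \<subseteq> y \<and> y \<subseteq> w2)) \<and>
        (x \<in> R `` {y} \<inter> Y \<longrightarrow>
           (\<exists>w1 \<in> R\<inverse> `` {x} \<inter> Y. \<exists>w2 \<in> R\<inverse> `` {x} \<inter> Y. w1 \<subseteq> y \<and> y \<subseteq> w2)))"

definition closed_tPS_sets ::
  "('a::{distrib_lattice,bounded_lattice} \<Rightarrow> 'a) \<Rightarrow> ('a \<Rightarrow> 'a) \<Rightarrow> 'a set set set" where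
  "closed_tPS_sets G F = {Y. closedin priestley_topology Y \<and> tPS_set G F Y}"

end

theory Submission imports Defs
begin

text \<open>Priestley duality turns closed subsets \<open>Y\<close> of \<open>X(A)\<close> into lattice congruences (identify
  \<open>a\<close> and \<open>b\<close> when they lie in the same members of \<open>Y\<close>), with inverse sending \<open>\<theta>\<close> to the set
  of its saturated prime filters. This is an order-reversing bijection, and it matches
  tPS-sets with congruences of the tense operators: \<open>G\<close> and \<open>F\<close> are the box and diamond of \<open>R\<close>,
  \<open>H\<close> and \<open>P\<close> those of the converse of \<open>R\<close>, and the tPS conditions say that these operators can
  be evaluated inside \<open>Y\<close>. A monolith therefore corresponds to a greatest proper closed tPS-set.\<close>

section \<open>Saturated prime filters\<close>

text \<open>The improper filter is allowed, so filters survive generation, saturation and inverse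
  images without a check of properness. Properness is recovered later from disjointness from an
  ideal, which contains \<bottom>.\<close>

definition lattice_filter :: "'a::bounded_lattice set \<Rightarrow> bool" where
  "lattice_filter S \<longleftrightarrow> \<top> \<in> S \<and> (\<forall>a b. a \<in> S \<longrightarrow> a \<le> b \<longrightarrow> b \<in> S) \<and>
     (\<forall>a b. a \<in> S \<longrightarrow> b \<in> S \<longrightarrow> a \<sqinter> b \<in> S)"

definition lattice_ideal :: "'a::bounded_lattice set \<Rightarrow> bool" where
  "lattice_ideal I \<longleftrightarrow> \<bottom> \<in> I \<and> (\<forall>a b. a \<in> I \<longrightarrow> b \<le> a \<longrightarrow> b \<in> I) \<and>
     (\<forall>a b. a \<in> I \<longrightarrow> b \<in> I \<longrightarrow> a \<squnion> b \<in> I)"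

text \<open>The lattice part of \<open>tDL_congruence\<close>, separated because the correspondence
  with closed sets is first set up for the lattice alone.\<close>

definition lattice_congruence :: "'a::lattice rel \<Rightarrow> bool" where
  "lattice_congruence \<theta> \<longleftrightarrow> equiv UNIV \<theta> \<and>
     (\<forall>a b c d. (a, b) \<in> \<theta> \<longrightarrow> (c, d) \<in> \<theta> \<longrightarrow> (a \<sqinter> c, b \<sqinter> d) \<in> \<theta> \<and> (a \<squnion> c, b \<squnion> d) \<in> \<theta>)"

lemma lattice_filterD:
  assumes "lattice_filter S"
  shows "\<top> \<in> S" "a \<in> S \<Longrightarrow> a \<le> b \<Longrightarrow> b \<in> S" "a \<in> S \<Longrightarrow> b \<in> S \<Longrightarrow> a \<sqinter> b \<in> S"
  using assms unfolding lattice_filter_def by blast+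

lemma lattice_idealD:
  assumes "lattice_ideal I"
  shows "\<bottom> \<in> I" "a \<in> I \<Longrightarrow> b \<le> a \<Longrightarrow> b \<in> I" "a \<in> I \<Longrightarrow> b \<in> I \<Longrightarrow> a \<squnion> b \<in> I"
  using assms unfolding lattice_ideal_def by blast+

lemma lattice_congruenceD:
  assumes "lattice_congruence \<theta>"
  shows "(a, a) \<in> \<theta>" "(a, b) \<in> \<theta> \<Longrightarrow> (b, a) \<in> \<theta>" "(a, b) \<in> \<theta> \<Longrightarrow> (b, c) \<in> \<theta> \<Longrightarrow> (a, c) \<in> \<theta>"
    "(a, b) \<in> \<theta> \<Longrightarrow> (c, d) \<in> \<theta> \<Longrightarrow> (a \<sqinter> c, b \<sqinter> d) \<in> \<theta>"
    "(a, b) \<in> \<theta> \<Longrightarrow> (c, d) \<in> \<theta> \<Longrightarrow> (a \<squnion> c, b \<squnion> d) \<in> \<theta>"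
proof -
  have "equiv UNIV \<theta>" using assms unfolding lattice_congruence_def by blast
  then show "(a, a) \<in> \<theta>" "(a, b) \<in> \<theta> \<Longrightarrow> (b, a) \<in> \<theta>"
    "(a, b) \<in> \<theta> \<Longrightarrow> (b, c) \<in> \<theta> \<Longrightarrow> (a, c) \<in> \<theta>"
    by (auto elim!: equivE dest: refl_onD symD transD)
  show "(a, b) \<in> \<theta> \<Longrightarrow> (c, d) \<in> \<theta> \<Longrightarrow> (a \<sqinter> c, b \<sqinter> d) \<in> \<theta>"
    "(a, b) \<in> \<theta> \<Longrightarrow> (c, d) \<in> \<theta> \<Longrightarrow> (a \<squnion> c, b \<squnion> d) \<in> \<theta>"
    using assms unfolding lattice_congruence_def by simp_all
qed

lemma lattice_congruence_Id: "lattice_congruence Id"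
  unfolding lattice_congruence_def by (simp add: equiv_def refl_on_def sym_def trans_def)

lemma prime_filterD:
  assumes "prime_filter T"
  shows "\<top> \<in> T" "\<bottom> \<notin> T" "a \<in> T \<Longrightarrow> a \<le> b \<Longrightarrow> b \<in> T"
    "a \<sqinter> b \<in> T \<longleftrightarrow> a \<in> T \<and> b \<in> T" "a \<squnion> b \<in> T \<longleftrightarrow> a \<in> T \<or> b \<in> T"
proof -
  have up: "\<And>a b. a \<in> T \<Longrightarrow> a \<le> b \<Longrightarrow> b \<in> T"
    and "T \<noteq> {}" "T \<noteq> UNIV"
    and i: "\<And>a b. a \<in> T \<Longrightarrow> b \<in> T \<Longrightarrow> a \<sqinter> b \<in> T"
    and s: "\<And>a b. a \<squnion> b \<in> T \<Longrightarrow> a \<in> T \<or> b \<in> T"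
    using assms unfolding prime_filter_def by blast+
  show "\<top> \<in> T" using \<open>T \<noteq> {}\<close> up top_greatest by blast
  show "\<bottom> \<notin> T" using \<open>T \<noteq> UNIV\<close> up bot_least by blast
  show "a \<in> T \<Longrightarrow> a \<le> b \<Longrightarrow> b \<in> T" by (rule up)
  show "a \<sqinter> b \<in> T \<longleftrightarrow> a \<in> T \<and> b \<in> T" using i up[OF _ inf_le1] up[OF _ inf_le2] by blast
  show "a \<squnion> b \<in> T \<longleftrightarrow> a \<in> T \<or> b \<in> T" using s up[OF _ sup_ge1] up[OF _ sup_ge2] by blast
qed

lemma prime_filter_imp_lattice_filter: "prime_filter T \<Longrightarrow> lattice_filter T"
  unfolding lattice_filter_def
  by (intro conjI allI impI) (erule (2) prime_filterD(3) | simp add: prime_filterD(1,4))+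

lemma prime_filter_compl_lattice_ideal: "prime_filter T \<Longrightarrow> lattice_ideal (- T)"
  unfolding lattice_ideal_def
  by (intro conjI allI impI) (simp_all add: prime_filterD(2,5), metis prime_filterD(3))

lemma lattice_filter_principal: "lattice_filter {x. a \<le> x}"
  unfolding lattice_filter_def by auto

lemma lattice_ideal_principal: "lattice_ideal {x. x \<le> a}"
  unfolding lattice_ideal_def by auto

section \<open>Generated filters and ideals, and maximal filters avoiding an ideal\<close>

lemma lattice_filter_adjoin:
  assumes "lattice_filter S"
  shows "lattice_filter {z. \<exists>m\<in>S. m \<sqinter> a \<le> z}"
  unfolding lattice_filter_def
proof (intro conjI allI impI)
  show "\<top> \<in> {z. \<exists>m\<in>S. m \<sqinter> a \<le> z}" using lattice_filterD(1)[OF assms] by auto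
next
  fix x y assume "x \<in> {z. \<exists>m\<in>S. m \<sqinter> a \<le> z}" "x \<le> y"
  then show "y \<in> {z. \<exists>m\<in>S. m \<sqinter> a \<le> z}" using order_trans by blast
next
  fix x y assume "x \<in> {z. \<exists>m\<in>S. m \<sqinter> a \<le> z}" "y \<in> {z. \<exists>m\<in>S. m \<sqinter> a \<le> z}"
  then obtain m n where "m \<in> S" "n \<in> S" "m \<sqinter> a \<le> x" "n \<sqinter> a \<le> y" by blast
  moreover from this have "(m \<sqinter> n) \<sqinter> a \<le> x \<sqinter> y"
    using order_trans[OF inf_mono[OF inf_le1 order_refl]]
      order_trans[OF inf_mono[OF inf_le2 order_refl]] by (intro le_infI)
  ultimately show "x \<sqinter> y \<in> {z. \<exists>m\<in>S. m \<sqinter> a \<le> z}" using lattice_filterD(3)[OF assms] by blast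
qed

lemma lattice_ideal_adjoin:
  assumes "lattice_ideal I"
  shows "lattice_ideal {z. \<exists>i\<in>I. z \<le> i \<squnion> a}"
  unfolding lattice_ideal_def
proof (intro conjI allI impI)
  show "\<bottom> \<in> {z. \<exists>i\<in>I. z \<le> i \<squnion> a}" using lattice_idealD(1)[OF assms] by auto
next
  fix x y assume "x \<in> {z. \<exists>i\<in>I. z \<le> i \<squnion> a}" "y \<le> x"
  then show "y \<in> {z. \<exists>i\<in>I. z \<le> i \<squnion> a}" using order_trans by blast
next
  fix x y assume "x \<in> {z. \<exists>i\<in>I. z \<le> i \<squnion> a}" "y \<in> {z. \<exists>i\<in>I. z \<le> i \<squnion> a}"
  then obtain m n where "m \<in> I" "n \<in> I" "x \<le> m \<squnion> a" "y \<le> n \<squnion> a" by blast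
  moreover from this have "x \<squnion> y \<le> (m \<squnion> n) \<squnion> a"
    using order_trans[OF _ sup_mono[OF sup_ge1 order_refl]]
      order_trans[OF _ sup_mono[OF sup_ge2 order_refl]] by (intro le_supI)
  ultimately show "x \<squnion> y \<in> {z. \<exists>i\<in>I. z \<le> i \<squnion> a}" using lattice_idealD(3)[OF assms] by blast
qed

text \<open>If \<open>a\<close> is outside \<open>M\<close>, then by maximality the filter generated
  by \<open>M\<close> and \<open>a\<close> meets \<open>I\<close>, so some
  \<open>m \<sqinter> a\<close> with \<open>m\<close> in \<open>M\<close> is in \<open>I\<close>. If
  \<open>a\<close> and \<open>b\<close> were both outside, distributivity would put
  \<open>(m \<sqinter> n) \<sqinter> (a \<squnion> b)\<close> into \<open>I\<close>, although it
  lies in \<open>M\<close> as soon as \<open>a \<squnion> b\<close> does.\<close>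

lemma maximal_disjoint_filter_prime:
  fixes M :: "'a::{distrib_lattice,bounded_lattice} set"
  assumes M: "lattice_filter M" and I: "lattice_ideal I" and disj: "M \<inter> I = {}"
    and max: "\<And>X. lattice_filter X \<Longrightarrow> X \<inter> I = {} \<Longrightarrow> M \<subseteq> X \<Longrightarrow> X = M"
  shows "prime_filter M"
proof -
  have adjoin: "\<exists>m\<in>M. m \<sqinter> a \<in> I" if "a \<notin> M" for a
  proof (rule ccontr)
    let ?X = "{z. \<exists>m\<in>M. m \<sqinter> a \<le> z}"
    assume no: "\<not> (\<exists>m\<in>M. m \<sqinter> a \<in> I)"
    have "?X \<inter> I = {}" using no lattice_idealD(2)[OF I] by blast
    moreover have "M \<subseteq> ?X" using inf_le1 by blast
    ultimately have "?X = M" using max lattice_filter_adjoin[OF M] by blast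
    moreover have "a \<in> ?X" using lattice_filterD(1)[OF M] by auto
    ultimately show False using that by blast
  qed
  have "a \<in> M \<or> b \<in> M" if ab: "a \<squnion> b \<in> M" for a b
  proof (rule ccontr)
    assume "\<not> ?thesis"
    then obtain m n where m: "m \<in> M" "m \<sqinter> a \<in> I" and n: "n \<in> M" "n \<sqinter> b \<in> I"
      using adjoin by blast
    have "(m \<sqinter> n) \<sqinter> (a \<squnion> b) \<le> (m \<sqinter> a) \<squnion> (n \<sqinter> b)"
      by (simp add: inf_sup_distrib1 le_infI1 le_infI2 le_supI1 le_supI2)
    then have "(m \<sqinter> n) \<sqinter> (a \<squnion> b) \<in> I"
      using lattice_idealD(2,3)[OF I] m n by blast
    moreover have "(m \<sqinter> n) \<sqinter> (a \<squnion> b) \<in> M"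
      using lattice_filterD(3)[OF M] m n ab by blast
    ultimately show False using disj by blast
  qed
  moreover have "\<bottom> \<notin> M" using disj lattice_idealD(1)[OF I] by blast
  ultimately show ?thesis
    using lattice_filterD(1)[OF M] M unfolding prime_filter_def lattice_filter_def by blast
qed

text \<open>Zorn's lemma: the union of a nonempty chain of filters is a filter, since any two of its
  elements already lie in one member of the chain.\<close>

lemma maximal_disjoint_filter_exists:
  assumes S: "lattice_filter S" and disj: "S \<inter> I = {}"
  obtains M where "lattice_filter M" "S \<subseteq> M" "M \<inter> I = {}"
    "\<And>X. lattice_filter X \<Longrightarrow> X \<inter> I = {} \<Longrightarrow> M \<subseteq> X \<Longrightarrow> X = M"
proof -
  let ?A = "{X. lattice_filter X \<and> S \<subseteq> X \<and> X \<inter> I = {}}"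
  have "\<exists>M\<in>?A. \<forall>X\<in>?A. M \<subseteq> X \<longrightarrow> X = M"
  proof (rule subset_Zorn_nonempty)
    show "?A \<noteq> {}" using S disj by blast
  next
    fix C assume C: "C \<noteq> {}" "subset.chain ?A C"
    then have sub: "C \<subseteq> ?A" and ch: "\<And>X Y. X \<in> C \<Longrightarrow> Y \<in> C \<Longrightarrow> X \<subseteq> Y \<or> Y \<subseteq> X"
      unfolding subset_chain_def by blast+
    have "lattice_filter (\<Union>C)"
      unfolding lattice_filter_def
    proof (intro conjI allI impI)
      show "\<top> \<in> \<Union>C" using C(1) sub lattice_filterD(1) by blast
    next
      fix a b assume "a \<in> \<Union>C" "a \<le> b"
      then show "b \<in> \<Union>C" using sub lattice_filterD(2) by blast
    next
      fix a b assume "a \<in> \<Union>C" "b \<in> \<Union>C"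
      then obtain X where "X \<in> C" "a \<in> X" "b \<in> X" using ch by blast
      then show "a \<sqinter> b \<in> \<Union>C" using sub lattice_filterD(3) by blast
    qed
    then show "\<Union>C \<in> ?A" using C(1) sub by blast
  qed
  then obtain M where "M \<in> ?A" "\<forall>X\<in>?A. M \<subseteq> X \<longrightarrow> X = M" by blast
  then show thesis by (intro that[of M]) auto
qed

text \<open>Upward closure is the point: if \<open>s\<close> in \<open>S\<close> is congruent to
  \<open>a\<close> and \<open>a \<le> b\<close>, then \<open>s \<squnion> b\<close> is in
  \<open>S\<close> and congruent to \<open>a \<squnion> b = b\<close>.\<close>

lemma lattice_filter_saturation:
  assumes "lattice_congruence \<theta>" and S: "lattice_filter S"
  shows "lattice_filter (\<theta> `` S)"
  unfolding lattice_filter_def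
proof (intro conjI allI impI)
  note \<theta> = lattice_congruenceD[OF assms(1)]
  show "\<top> \<in> \<theta> `` S" using \<theta>(1) lattice_filterD(1)[OF S] by blast
  show "b \<in> \<theta> `` S" if "a \<in> \<theta> `` S" "a \<le> b" for a b
  proof -
    obtain s where s: "s \<in> S" "(s, a) \<in> \<theta>" using \<open>a \<in> \<theta> `` S\<close> by blast
    then have "(s \<squnion> b, a \<squnion> b) \<in> \<theta>" by (intro \<theta>(1,5))
    moreover have "s \<squnion> b \<in> S" using s lattice_filterD(2)[OF S] sup_ge1 by blast
    ultimately show ?thesis using \<open>a \<le> b\<close> by (metis ImageI sup.absorb2)
  qed
  show "a \<sqinter> b \<in> \<theta> `` S" if "a \<in> \<theta> `` S" "b \<in> \<theta> `` S" for a b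
    using that \<theta>(4) lattice_filterD(3)[OF S] by blast
qed

text \<open>Order dual of the filter case, with \<open>s \<sqinter> b\<close> in place of
  \<open>s \<squnion> b\<close>.\<close>

lemma lattice_ideal_saturation:
  assumes "lattice_congruence \<theta>" and S: "lattice_ideal S"
  shows "lattice_ideal (\<theta> `` S)"
  unfolding lattice_ideal_def
proof (intro conjI allI impI)
  note \<theta> = lattice_congruenceD[OF assms(1)]
  show "\<bottom> \<in> \<theta> `` S" using \<theta>(1) lattice_idealD(1)[OF S] by blast
  show "b \<in> \<theta> `` S" if "a \<in> \<theta> `` S" "b \<le> a" for a b
  proof -
    obtain s where s: "s \<in> S" "(s, a) \<in> \<theta>" using \<open>a \<in> \<theta> `` S\<close> by blast
    then have "(s \<sqinter> b, a \<sqinter> b) \<in> \<theta>" by (intro \<theta>(1,4))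
    moreover have "s \<sqinter> b \<in> S" using s lattice_idealD(2)[OF S] inf_le1 by blast
    ultimately show ?thesis using \<open>b \<le> a\<close> by (metis ImageI inf.absorb2)
  qed
  show "a \<squnion> b \<in> \<theta> `` S" if "a \<in> \<theta> `` S" "b \<in> \<theta> `` S" for a b
    using that \<theta>(5) lattice_idealD(3)[OF S] by blast
qed

text \<open>For a lattice congruence \<theta> these are the prime filters that are unions of
  \<theta>-classes, that is, the preimages of the prime filters of the quotient.\<close>

definition saturated_primes :: "'a::{distrib_lattice,bounded_lattice} rel \<Rightarrow> 'a set set" where
  "saturated_primes \<theta> = {T \<in> prime_filters. \<theta> `` T \<subseteq> T}"

text \<open>A filter maximal among those disjoint from a saturated ideal is itself saturated, since
  its saturation is still disjoint from the ideal.\<close>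

lemma saturated_prime_filter_theorem:
  fixes \<theta> :: "'a::{distrib_lattice,bounded_lattice} rel"
  assumes \<theta>: "lattice_congruence \<theta>" and S: "lattice_filter S" and I: "lattice_ideal I"
    and sat: "\<theta> `` I \<subseteq> I" and disj: "S \<inter> I = {}"
  obtains T where "T \<in> saturated_primes \<theta>" "S \<subseteq> T" "T \<inter> I = {}"
proof -
  obtain M where M: "lattice_filter M" "S \<subseteq> M" "M \<inter> I = {}"
    and max: "\<And>X. lattice_filter X \<Longrightarrow> X \<inter> I = {} \<Longrightarrow> M \<subseteq> X \<Longrightarrow> X = M"
    using maximal_disjoint_filter_exists[OF S disj] by blast
  have "(\<theta> `` M) \<inter> I = {}"
    using M(3) sat lattice_congruenceD(2)[OF \<theta>] by blast
  moreover have "M \<subseteq> \<theta> `` M" using lattice_congruenceD(1)[OF \<theta>] by blast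
  ultimately have "\<theta> `` M = M" using max lattice_filter_saturation[OF \<theta> M(1)] by blast
  moreover have "prime_filter M"
    using maximal_disjoint_filter_prime[OF M(1) I M(3)] max by blast
  ultimately show thesis
    using that[of M] M unfolding saturated_primes_def prime_filters_def by blast
qed

text \<open>The classical separation theorem is the case of the identity congruence, for which every
  set is saturated.\<close>

lemma prime_filter_theorem:
  fixes S I :: "'a::{distrib_lattice,bounded_lattice} set"
  assumes "lattice_filter S" "lattice_ideal I" "S \<inter> I = {}"
  obtains T where "T \<in> prime_filters" "S \<subseteq> T" "T \<inter> I = {}"
  using saturated_prime_filter_theorem[OF lattice_congruence_Id assms(1,2) _ assms(3)]
  unfolding saturated_primes_def by auto

section \<open>Closed sets and lattice congruences\<close>

definition set_congruence :: "'a::{distrib_lattice,bounded_lattice} set set \<Rightarrow> 'a rel" where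
  "set_congruence Y = {(a, b). \<forall>T\<in>Y. a \<in> T \<longleftrightarrow> b \<in> T}"

lemma saturated_primes_mem_iff:
  assumes "lattice_congruence \<theta>" "T \<in> saturated_primes \<theta>" "(a, b) \<in> \<theta>"
  shows "a \<in> T \<longleftrightarrow> b \<in> T"
  using assms lattice_congruenceD(2)[OF assms(1)] unfolding saturated_primes_def by blast

text \<open>The quotient has enough prime filters: unless \<open>a\<close> lies below
  \<open>b\<close> modulo \<theta>, which means that \<open>a\<close> is congruent to
  \<open>a \<sqinter> b\<close>, some saturated prime filter contains \<open>a\<close> and avoids
  the saturation of the principal ideal of \<open>b\<close>.\<close>

lemma set_congruence_saturated_primes:
  assumes \<theta>: "lattice_congruence \<theta>"
  shows "set_congruence (saturated_primes \<theta>) = \<theta>"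
proof
  show "\<theta> \<subseteq> set_congruence (saturated_primes \<theta>)"
    using saturated_primes_mem_iff[OF \<theta>] unfolding set_congruence_def by blast
  note \<theta>D = lattice_congruenceD[OF \<theta>]
  have le: "(a, a \<sqinter> b) \<in> \<theta>" if all: "\<And>T. T \<in> saturated_primes \<theta> \<Longrightarrow> a \<in> T \<Longrightarrow> b \<in> T" for a b
  proof (rule ccontr)
    assume no: "(a, a \<sqinter> b) \<notin> \<theta>"
    let ?I = "\<theta> `` {x. x \<le> b}"
    have "{x. a \<le> x} \<inter> ?I = {}"
    proof (rule ccontr)
      assume "\<not> ?thesis"
      then obtain x j where "a \<le> x" "j \<le> b" "(j, x) \<in> \<theta>" by blast
      \<comment> \<open>Meeting the pair \<open>(j, x)\<close> with \<open>a\<close> makes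
        \<open>a\<close> congruent to \<open>a \<sqinter> j\<close>. Meeting that pair with
        \<open>b\<close> makes \<open>a \<sqinter> b\<close> congruent to
        \<open>a \<sqinter> j\<close> as well, hence to \<open>a\<close>.\<close>
      have "(a \<sqinter> j, a \<sqinter> x) \<in> \<theta>" using \<open>(j, x) \<in> \<theta>\<close> \<theta>D(1,4) by blast
      then have aj: "(a, a \<sqinter> j) \<in> \<theta>" using \<open>a \<le> x\<close> \<theta>D(2) by (simp add: inf.absorb1)
      then have "(a \<sqinter> b, a \<sqinter> j \<sqinter> b) \<in> \<theta>" using \<theta>D(1,4) by blast
      then have "(a \<sqinter> b, a \<sqinter> j) \<in> \<theta>" using \<open>j \<le> b\<close> by (simp add: inf.absorb1 inf.assoc)
      then show False using aj no \<theta>D(2,3) by blast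
    qed
    moreover have "\<theta> `` ?I \<subseteq> ?I" using \<theta>D(3) by blast
    ultimately obtain T where "T \<in> saturated_primes \<theta>" "{x. a \<le> x} \<subseteq> T" "T \<inter> ?I = {}"
      using saturated_prime_filter_theorem[OF \<theta> lattice_filter_principal
          lattice_ideal_saturation[OF \<theta> lattice_ideal_principal]] by blast
    moreover have "b \<in> ?I" using \<theta>D(1) by blast
    ultimately show False using all by blast
  qed
  show "set_congruence (saturated_primes \<theta>) \<subseteq> \<theta>"
  proof (rule subrelI)
    fix a b assume "(a, b) \<in> set_congruence (saturated_primes \<theta>)"
    then have "(a, a \<sqinter> b) \<in> \<theta>" "(b, b \<sqinter> a) \<in> \<theta>"
      unfolding set_congruence_def by (auto intro: le)
    then show "(a, b) \<in> \<theta>" using \<theta>D(2,3) by (metis inf.commute)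
  qed
qed

section \<open>The Priestley topology: closed sets are recovered from their congruences\<close>

lemma lattice_congruence_set_congruence:
  assumes "Y \<subseteq> prime_filters"
  shows "lattice_congruence (set_congruence Y)"
proof -
  have "\<And>T. T \<in> Y \<Longrightarrow> prime_filter T" using assms unfolding prime_filters_def by blast
  note pf = prime_filterD(4,5)[OF this]
  show ?thesis
    unfolding lattice_congruence_def
  proof (intro conjI allI impI)
    show "equiv UNIV (set_congruence Y)"
      unfolding set_congruence_def by (intro equivI) (auto intro: refl_onI symI transI)
  qed (use pf in \<open>simp_all add: set_congruence_def\<close>)
qed

text \<open>Finite intersections of subbasic sets reduce to one difference of two sets
  \<open>priestley_sigma\<close>: positive conditions combine by \<sqinter>, negative ones by
  \<squnion>. A lone positive condition is paired with \<bottom>, a lone negative one with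
  \<top>.\<close>

lemma priestley_open_basic:
  assumes "openin priestley_topology U" "T \<in> U"
  obtains a b where "a \<in> T" "b \<notin> T" "\<And>T'. T' \<in> prime_filters \<Longrightarrow> a \<in> T' \<Longrightarrow> b \<notin> T' \<Longrightarrow> T' \<in> U"
proof -
  have T: "prime_filter T"
    using openin_subset[OF assms(1)] assms(2)
    unfolding topspace_priestley_topology prime_filters_def by blast
  have "generate_topology_on
      (range priestley_sigma \<union> range (\<lambda>a. prime_filters - priestley_sigma a)) U"
    using assms(1) unfolding priestley_topology_def openin_topology_generated_by_iff .
  then have "T \<in> U \<Longrightarrow> \<exists>a b. a \<in> T \<and> b \<notin> T \<and>
      (\<forall>T'\<in>prime_filters. a \<in> T' \<longrightarrow> b \<notin> T' \<longrightarrow> T' \<in> U)"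
  proof (induction rule: generate_topology_on.induct)
    case Empty
    then show ?case by simp
  next
    case (Int U V)
    obtain a b where "a \<in> T" "b \<notin> T"
      "\<forall>T'\<in>prime_filters. a \<in> T' \<longrightarrow> b \<notin> T' \<longrightarrow> T' \<in> U"
      using Int.IH(1) Int.prems by blast
    moreover obtain c d where "c \<in> T" "d \<notin> T"
      "\<forall>T'\<in>prime_filters. c \<in> T' \<longrightarrow> d \<notin> T' \<longrightarrow> T' \<in> V"
      using Int.IH(2) Int.prems by blast
    ultimately have "a \<sqinter> c \<in> T" "b \<squnion> d \<notin> T"
      "\<forall>T'\<in>prime_filters. a \<sqinter> c \<in> T' \<longrightarrow> b \<squnion> d \<notin> T' \<longrightarrow> T' \<in> U \<inter> V"
      using prime_filterD(4,5)[OF T] by (simp_all add: prime_filters_def prime_filterD(4,5))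
    then show ?case by blast
  next
    case (UN K)
    then obtain k where "k \<in> K" "T \<in> k" by blast
    with UN.IH obtain a b where "a \<in> T" "b \<notin> T"
      "\<forall>T'\<in>prime_filters. a \<in> T' \<longrightarrow> b \<notin> T' \<longrightarrow> T' \<in> k" by blast
    with \<open>k \<in> K\<close> show ?case by blast
  next
    case (Basis s)
    then consider a where "s = priestley_sigma a" | a where "s = prime_filters - priestley_sigma a"
      by blast
    then show ?case
    proof cases
      case (1 a)
      then show ?thesis
        using Basis(2) prime_filterD(2)[OF T] unfolding priestley_sigma_def by blast
    next
      case (2 a)
      then show ?thesis
        using Basis(2) prime_filterD(1)[OF T] unfolding priestley_sigma_def by blast
    qed
  qed
  then show thesis using assms(2) that by blast
qed

text \<open>A prime filter fails to be saturated exactly when some pair \<open>(a, b)\<close> in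
  \<theta> has \<open>a\<close> inside and \<open>b\<close> outside it, and each such pair defines
  an open set.\<close>

lemma closedin_saturated_primes:
  "closedin priestley_topology (saturated_primes \<theta>)"
proof -
  have open_sigma: "openin priestley_topology (priestley_sigma a)"
    "openin priestley_topology (prime_filters - priestley_sigma a)" for a
    unfolding priestley_topology_def by (auto intro: topology_generated_by_Basis)
  have "prime_filters - saturated_primes \<theta> =
      (\<Union>(a, b)\<in>\<theta>. priestley_sigma a \<inter> (prime_filters - priestley_sigma b))"
    unfolding saturated_primes_def priestley_sigma_def by blast
  also have "openin priestley_topology \<dots>"
    using open_sigma by (intro openin_Union) auto
  finally show ?thesis
    unfolding closedin_def topspace_priestley_topology
    by (simp add: saturated_primes_def)
qed

text \<open>A point \<open>T\<close> outside \<open>Y\<close> has a basic neighbourhood, given by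
  \<open>a\<close> inside and \<open>b\<close> outside, that misses \<open>Y\<close>. Every member
  of \<open>Y\<close> containing \<open>a\<close> then contains \<open>b\<close>, so
  \<open>Y\<close> identifies \<open>a\<close> with \<open>a \<sqinter> b\<close>, while
  \<open>T\<close> contains only the first.\<close>

lemma saturated_primes_set_congruence:
  assumes Y: "closedin priestley_topology Y"
  shows "saturated_primes (set_congruence Y) = Y"
proof
  have sub: "Y \<subseteq> prime_filters"
    using closedin_subset[OF Y] unfolding topspace_priestley_topology .
  then show "Y \<subseteq> saturated_primes (set_congruence Y)"
    unfolding saturated_primes_def set_congruence_def by blast
  show "saturated_primes (set_congruence Y) \<subseteq> Y"
  proof (rule subsetI, rule ccontr)
    fix T assume T: "T \<in> saturated_primes (set_congruence Y)" "T \<notin> Y"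
    have "openin priestley_topology (prime_filters - Y)"
      using Y unfolding closedin_def topspace_priestley_topology by blast
    moreover have "T \<in> prime_filters - Y" using T unfolding saturated_primes_def by blast
    ultimately obtain a b where ab: "a \<in> T" "b \<notin> T"
      and out: "\<And>T'. T' \<in> prime_filters \<Longrightarrow> a \<in> T' \<Longrightarrow> b \<notin> T' \<Longrightarrow> T' \<in> prime_filters - Y"
      using priestley_open_basic by blast
    have inf: "x \<sqinter> y \<in> T' \<longleftrightarrow> x \<in> T' \<and> y \<in> T'" if "T' \<in> prime_filters" for T' :: "'a set" and x y
      using that prime_filterD(4) unfolding prime_filters_def by blast
    have "(a, a \<sqinter> b) \<in> set_congruence Y"
      unfolding set_congruence_def using out sub inf by blast
    moreover have "T \<in> prime_filters" "set_congruence Y `` T \<subseteq> T"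
      using T unfolding saturated_primes_def by blast+
    ultimately have "a \<sqinter> b \<in> T" using ab by blast
    then show False using ab inf \<open>T \<in> prime_filters\<close> by blast
  qed
qed

section \<open>The tense operators and the dual relation\<close>

text \<open>Time reversal: the axioms are symmetric in the pairs \<open>G\<close>, \<open>F\<close>
  and \<open>H\<close>, \<open>P\<close>, so later facts need proof for one pair only.\<close>

lemma tDL_algebra_converse:
  "tDL_algebra G H F P \<Longrightarrow> tDL_algebra H G P F"
  by (simp add: tDL_algebra_def)

text \<open>The adjunction inequalities give this: \<open>H a\<close> in \<open>T\<close> puts
  \<open>F (H a)\<close>, hence \<open>a\<close>, into \<open>S\<close>; and \<open>a\<close> in
  \<open>S\<close> puts \<open>G (P a)\<close> into \<open>S\<close>, hence \<open>P a\<close> into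
  \<open>T\<close>.\<close>

lemma tense_rel_converse_subset:
  assumes "tDL_algebra G H F P"
  shows "(tense_rel G F)\<inverse> \<subseteq> tense_rel H P"
proof (rule subrelI)
  interpret tDL_algebra G H F P by fact
  fix T S assume "(T, S) \<in> (tense_rel G F)\<inverse>"
  then have pf: "S \<in> prime_filters" "T \<in> prime_filters"
    and R: "\<And>a. G a \<in> S \<Longrightarrow> a \<in> T" "\<And>a. a \<in> T \<Longrightarrow> F a \<in> S"
    unfolding tense_rel_def by blast+
  then have "\<And>a b. a \<in> S \<Longrightarrow> a \<le> b \<Longrightarrow> b \<in> S"
    using prime_filterD(3) unfolding prime_filters_def by blast
  then have "\<And>a. H a \<in> T \<Longrightarrow> a \<in> S" "\<And>a. a \<in> S \<Longrightarrow> P a \<in> T"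
    using R F_H_le le_G_P by blast+
  then show "(T, S) \<in> tense_rel H P" using pf unfolding tense_rel_def by blast
qed

lemma tense_rel_converse:
  assumes "tDL_algebra G H F P"
  shows "tense_rel H P = (tense_rel G F)\<inverse>"
  using tense_rel_converse_subset[OF assms]
    tense_rel_converse_subset[OF tDL_algebra_converse[OF assms]]
  by fastforce

context tDL_algebra
begin

lemma G_mono: "a \<le> b \<Longrightarrow> G a \<le> G b"
  by (metis G_inf inf.absorb_iff1)

lemma F_mono: "a \<le> b \<Longrightarrow> F a \<le> F b"
  by (metis F_sup sup.absorb_iff2)

lemma lattice_filter_vimage_G:
  assumes "prime_filter S"
  shows "lattice_filter {a. G a \<in> S}"
  using prime_filterD[OF assms] G_mono unfolding lattice_filter_def
  by (auto simp: G_top G_inf)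

lemma lattice_ideal_vimage_F:
  assumes "prime_filter S"
  shows "lattice_ideal {a. F a \<notin> S}"
  using prime_filterD[OF assms] F_mono unfolding lattice_ideal_def
  by (auto simp: F_bot F_sup)

text \<open>When \<open>G a\<close> is not in \<open>S\<close>, a successor missing \<open>a\<close>
  is a prime filter that contains all \<open>b\<close> with \<open>G b\<close> in \<open>S\<close>
  and avoids the ideal generated by \<open>a\<close> and all \<open>b\<close> with
  \<open>F b\<close> not in \<open>S\<close>. The two sets are disjoint by \<open>G_sup_le\<close>
  and primeness of \<open>S\<close>.\<close>

lemma G_mem_iff:
  assumes "S \<in> prime_filters"
  shows "G a \<in> S \<longleftrightarrow> (\<forall>T. (S, T) \<in> tense_rel G F \<longrightarrow> a \<in> T)"
proof (intro iffI allI impI)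
  fix T assume "G a \<in> S" "(S, T) \<in> tense_rel G F"
  then show "a \<in> T" unfolding tense_rel_def by blast
next
  assume all: "\<forall>T. (S, T) \<in> tense_rel G F \<longrightarrow> a \<in> T"
  have S: "prime_filter S" using assms unfolding prime_filters_def by blast
  note S' = prime_filterD[OF S]
  let ?I = "{z. \<exists>i\<in>{b. F b \<notin> S}. z \<le> i \<squnion> a}"
  show "G a \<in> S"
  proof (rule ccontr)
    assume Ga: "G a \<notin> S"
    have "{b. G b \<in> S} \<inter> ?I = {}"
    proof (rule ccontr)
      assume "\<not> ?thesis"
      then obtain x i where "G x \<in> S" "F i \<notin> S" "x \<le> a \<squnion> i" by (auto simp: sup.commute)
      then have "G a \<squnion> F i \<in> S" using G_mono G_sup_le S'(3) by blast
      then show False using Ga \<open>F i \<notin> S\<close> S'(5) by blast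
    qed
    then obtain T where T: "T \<in> prime_filters" "{b. G b \<in> S} \<subseteq> T" "T \<inter> ?I = {}"
      using prime_filter_theorem[OF lattice_filter_vimage_G[OF S]
          lattice_ideal_adjoin[OF lattice_ideal_vimage_F[OF S]]] by blast
    have "{b. F b \<notin> S} \<subseteq> ?I" using sup_ge1 by blast
    then have "(S, T) \<in> tense_rel G F"
      using T assms unfolding tense_rel_def by blast
    moreover have "a \<in> ?I" using F_bot S'(2) by (auto intro!: exI[of _ "\<bottom>"])
    ultimately show False using all T(3) by blast
  qed
qed

text \<open>Dual construction: now \<open>a\<close> is adjoined to the filter instead of the ideal,
  and \<open>G_F_le\<close> supplies the disjointness.\<close>

lemma F_mem_iff:
  assumes "S \<in> prime_filters"
  shows "F a \<in> S \<longleftrightarrow> (\<exists>T. (S, T) \<in> tense_rel G F \<and> a \<in> T)"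
proof
  assume "\<exists>T. (S, T) \<in> tense_rel G F \<and> a \<in> T"
  then show "F a \<in> S" unfolding tense_rel_def by blast
next
  assume Fa: "F a \<in> S"
  have S: "prime_filter S" using assms unfolding prime_filters_def by blast
  note S' = prime_filterD[OF S]
  let ?X = "{z. \<exists>m\<in>{b. G b \<in> S}. m \<sqinter> a \<le> z}"
  have "?X \<inter> {b. F b \<notin> S} = {}"
  proof (rule ccontr)
    assume "\<not> ?thesis"
    then obtain x i where "G x \<in> S" "F i \<notin> S" "x \<sqinter> a \<le> i" by blast
    then have "G x \<sqinter> F a \<in> S" using Fa S'(4) by blast
    then have "F i \<in> S" using G_F_le F_mono[OF \<open>x \<sqinter> a \<le> i\<close>] S'(3) by blast
    then show False using \<open>F i \<notin> S\<close> by blast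
  qed
  then obtain T where T: "T \<in> prime_filters" "?X \<subseteq> T" "T \<inter> {b. F b \<notin> S} = {}"
    using prime_filter_theorem[OF lattice_filter_adjoin[OF lattice_filter_vimage_G[OF S]]
        lattice_ideal_vimage_F[OF S]] by blast
  have "{b. G b \<in> S} \<subseteq> ?X" using inf_le1 by blast
  then have "(S, T) \<in> tense_rel G F"
    using T assms unfolding tense_rel_def by blast
  moreover have "a \<in> ?X" using G_top S'(1) by (auto intro!: exI[of _ "\<top>"])
  ultimately show "\<exists>T. (S, T) \<in> tense_rel G F \<and> a \<in> T" using T(2) by blast
qed

end

section \<open>The tPS conditions and compatibility with the operators\<close>

text \<open>Condition (tc1); (tc2) is the same condition for the pair \<open>H\<close>, \<open>P\<close>, whose dual relation
  is the converse one.\<close>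

definition tc1 :: "('a::{distrib_lattice,bounded_lattice} \<Rightarrow> 'a) \<Rightarrow> ('a \<Rightarrow> 'a) \<Rightarrow> 'a set set \<Rightarrow> bool" where
  "tc1 G F Y \<longleftrightarrow> (\<forall>x y. x \<in> Y \<longrightarrow> (x, y) \<in> tense_rel G F \<longrightarrow>
     (\<exists>w\<in>Y. (x, w) \<in> tense_rel G F \<and> w \<subseteq> y) \<and> (\<exists>w\<in>Y. (x, w) \<in> tense_rel G F \<and> y \<subseteq> w))"

text \<open>The bounds on \<open>x\<close> and \<open>y\<close> are implied by the relation, which
  holds only between prime filters, and the two witnesses can be chosen independently.\<close>

lemma tc1_iff:
  "tc1 G F Y \<longleftrightarrow> (\<forall>x\<in>prime_filters. \<forall>y\<in>prime_filters.
     x \<in> (tense_rel G F)\<inverse> `` {y} \<inter> Y \<longrightarrow>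
       (\<exists>w1 \<in> tense_rel G F `` {x} \<inter> Y. \<exists>w2 \<in> tense_rel G F `` {x} \<inter> Y. w1 \<subseteq> y \<and> y \<subseteq> w2))"
proof -
  have dom: "(\<forall>x\<in>prime_filters. \<forall>y\<in>prime_filters. x \<in> (tense_rel G F)\<inverse> `` {y} \<inter> Y \<longrightarrow> Q x y) \<longleftrightarrow>
      (\<forall>x y. x \<in> Y \<longrightarrow> (x, y) \<in> tense_rel G F \<longrightarrow> Q x y)" for Q :: "'a set \<Rightarrow> 'a set \<Rightarrow> bool"
    unfolding tense_rel_def by blast
  have "(\<exists>w1 \<in> S `` {x} \<inter> Y. \<exists>w2 \<in> S `` {x} \<inter> Y. w1 \<subseteq> y \<and> y \<subseteq> w2) \<longleftrightarrow>
      (\<exists>w\<in>Y. (x, w) \<in> S \<and> w \<subseteq> y) \<and> (\<exists>w\<in>Y. (x, w) \<in> S \<and> y \<subseteq> w)" for S and x y :: "'a set"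
    by blast
  then show ?thesis unfolding tc1_def dom by simp
qed

lemma tPS_set_iff:
  assumes "tDL_algebra G H F P"
  shows "tPS_set G F Y \<longleftrightarrow> Y \<subseteq> prime_filters \<and> tc1 G F Y \<and> tc1 H P Y"
  unfolding tPS_set_def tc1_iff Let_def tense_rel_converse[OF assms] converse_converse
  by (simp only: ball_conj_distrib)

text \<open>Membership of \<open>G c\<close> and \<open>F c\<close> in a member of \<open>Y\<close>
  can be tested on successors inside \<open>Y\<close>: a successor missing \<open>c\<close> can be
  shrunk to one in \<open>Y\<close>, and a successor containing \<open>c\<close> can be enlarged to
  one in \<open>Y\<close>.\<close>

lemma tc1_imp_compatible:
  assumes "tDL_algebra G H F P" "Y \<subseteq> prime_filters" "tc1 G F Y"
    and ab: "(a, b) \<in> set_congruence Y"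
  shows "(G a, G b) \<in> set_congruence Y" "(F a, F b) \<in> set_congruence Y"
proof -
  interpret tDL_algebra G H F P by fact
  have ab': "a \<in> T \<longleftrightarrow> b \<in> T" if "T \<in> Y" for T
    using ab that unfolding set_congruence_def by blast
  have G_iff: "G c \<in> S \<longleftrightarrow> (\<forall>T\<in>Y. (S, T) \<in> tense_rel G F \<longrightarrow> c \<in> T)" if "S \<in> Y" for S c
    using G_mem_iff[of S c] assms(2,3) that unfolding tc1_def by (meson subsetD)
  have F_iff: "F c \<in> S \<longleftrightarrow> (\<exists>T\<in>Y. (S, T) \<in> tense_rel G F \<and> c \<in> T)" if "S \<in> Y" for S c
    using F_mem_iff[of S c] assms(2,3) that unfolding tc1_def by (meson subsetD)
  show "(G a, G b) \<in> set_congruence Y"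
    unfolding set_congruence_def using G_iff ab' by simp
  show "(F a, F b) \<in> set_congruence Y"
    unfolding set_congruence_def using F_iff ab' by auto
qed

lemma compatible_imp_tc1:
  assumes "tDL_algebra G H F P" and \<theta>: "lattice_congruence \<theta>"
    and comp: "\<And>a b. (a, b) \<in> \<theta> \<Longrightarrow> (G a, G b) \<in> \<theta> \<and> (F a, F b) \<in> \<theta>"
  shows "tc1 G F (saturated_primes \<theta>)"
  unfolding tc1_def
proof (intro allI impI)
  interpret tDL_algebra G H F P by fact
  note \<theta>D = lattice_congruenceD[OF \<theta>]
  fix S T assume S: "S \<in> saturated_primes \<theta>" and R: "(S, T) \<in> tense_rel G F"
  have pS: "prime_filter S" and pT: "prime_filter T"
    and RG: "{a. G a \<in> S} \<subseteq> T" and RF: "T \<subseteq> {a. F a \<in> S}"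
    using R unfolding tense_rel_def prime_filters_def by blast+
  have sat: "G a \<in> S \<longleftrightarrow> G b \<in> S" "F a \<in> S \<longleftrightarrow> F b \<in> S" if "(a, b) \<in> \<theta>" for a b
    using comp[OF that] saturated_primes_mem_iff[OF \<theta> S] by blast+
  \<comment> \<open>For the lower witness the ideal to avoid is the saturation of the complement of
    \<open>T\<close>. It misses the filter of all \<open>a\<close> with \<open>G a\<close> in
    \<open>S\<close>, because that filter is saturated and lies in \<open>T\<close>.\<close>
  have "{a. G a \<in> S} \<inter> \<theta> `` (- T) = {}" using RG sat(1) by blast
  moreover have "\<theta> `` (\<theta> `` (- T)) \<subseteq> \<theta> `` (- T)" using \<theta>D(3) by blast
  ultimately obtain w1 where
    w1: "w1 \<in> saturated_primes \<theta>" "{a. G a \<in> S} \<subseteq> w1" "w1 \<inter> \<theta> `` (- T) = {}"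
    using saturated_prime_filter_theorem[OF \<theta> lattice_filter_vimage_G[OF pS]
        lattice_ideal_saturation[OF \<theta> prime_filter_compl_lattice_ideal[OF pT]]] by blast
  have "w1 \<subseteq> T" using w1(3) \<theta>D(1) by blast
  \<comment> \<open>For the upper witness the ideal is already saturated, since \<open>F\<close>
    respects \<theta> and \<open>S\<close> is saturated, so \<open>T\<close> itself can be
    extended.\<close>
  have "T \<inter> {a. F a \<notin> S} = {}" using RF by blast
  moreover have "\<theta> `` {a. F a \<notin> S} \<subseteq> {a. F a \<notin> S}" using sat(2) by blast
  ultimately obtain w2 where
    w2: "w2 \<in> saturated_primes \<theta>" "T \<subseteq> w2" "w2 \<inter> {a. F a \<notin> S} = {}"
    using saturated_prime_filter_theorem[OF \<theta> prime_filter_imp_lattice_filter[OF pT]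
        lattice_ideal_vimage_F[OF pS]] by blast
  have "(S, w1) \<in> tense_rel G F" "(S, w2) \<in> tense_rel G F"
    using w1 w2 S RG RF \<open>w1 \<subseteq> T\<close> unfolding tense_rel_def saturated_primes_def by blast+
  then show "(\<exists>w\<in>saturated_primes \<theta>. (S, w) \<in> tense_rel G F \<and> w \<subseteq> T) \<and>
      (\<exists>w\<in>saturated_primes \<theta>. (S, w) \<in> tense_rel G F \<and> T \<subseteq> w)"
    using w1(1) w2(1,2) \<open>w1 \<subseteq> T\<close> by blast
qed

section \<open>The duality between congruences and closed tPS-sets\<close>

lemma tDL_congruence_iff:
  "tDL_congruence G H F P \<theta> \<longleftrightarrow> lattice_congruence \<theta> \<and>
     (\<forall>a b. (a, b) \<in> \<theta> \<longrightarrow>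
        (G a, G b) \<in> \<theta> \<and> (H a, H b) \<in> \<theta> \<and> (F a, F b) \<in> \<theta> \<and> (P a, P b) \<in> \<theta>)"
  unfolding tDL_congruence_def lattice_congruence_def by blast

text \<open>Condition \<open>tc1\<close> is used twice: for the algebra, giving \<open>G\<close> and
  \<open>F\<close>, and for its time reversal, giving \<open>H\<close> and \<open>P\<close>.\<close>

lemma tDL_congruence_set_congruence:
  assumes alg: "tDL_algebra G H F P" and "Y \<in> closed_tPS_sets G F"
  shows "tDL_congruence G H F P (set_congruence Y)"
proof -
  have "Y \<subseteq> prime_filters" "tc1 G F Y" "tc1 H P Y"
    using assms(2) unfolding closed_tPS_sets_def tPS_set_iff[OF alg] by blast+
  then show ?thesis
    unfolding tDL_congruence_iff
    by (simp add: lattice_congruence_set_congruence tc1_imp_compatible[OF alg]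
        tc1_imp_compatible[OF tDL_algebra_converse[OF alg]])
qed

lemma saturated_primes_closed_tPS_set:
  assumes alg: "tDL_algebra G H F P" and "tDL_congruence G H F P \<theta>"
  shows "saturated_primes \<theta> \<in> closed_tPS_sets G F"
proof -
  have \<theta>: "lattice_congruence \<theta>"
    and c: "\<And>a b. (a, b) \<in> \<theta> \<Longrightarrow> (G a, G b) \<in> \<theta> \<and> (F a, F b) \<in> \<theta>"
      "\<And>a b. (a, b) \<in> \<theta> \<Longrightarrow> (H a, H b) \<in> \<theta> \<and> (P a, P b) \<in> \<theta>"
    using assms(2) unfolding tDL_congruence_iff by blast+
  have "saturated_primes \<theta> \<subseteq> prime_filters" unfolding saturated_primes_def by blast
  then show ?thesis
    unfolding closed_tPS_sets_def tPS_set_iff[OF alg]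
    using closedin_saturated_primes compatible_imp_tc1[OF alg \<theta> c(1)]
      compatible_imp_tc1[OF tDL_algebra_converse[OF alg] \<theta> c(2)] by blast
qed

lemma set_congruence_antimono: "Y \<subseteq> Z \<Longrightarrow> set_congruence Z \<subseteq> set_congruence Y"
  unfolding set_congruence_def by blast

lemma saturated_primes_antimono: "\<theta> \<subseteq> \<psi> \<Longrightarrow> saturated_primes \<psi> \<subseteq> saturated_primes \<theta>"
  unfolding saturated_primes_def by blast

theorem theorem4p17:
  fixes G H F P :: "'a::{distrib_lattice,bounded_lattice} \<Rightarrow> 'a"
  assumes "tDL_algebra G H F P"
  shows "tDL_subdirectly_irreducible G H F P \<longleftrightarrow>
    (\<exists>Z \<in> closed_tPS_sets G F - {prime_filters}.
       \<forall>Y \<in> closed_tPS_sets G F - {prime_filters}. Y \<subseteq> Z)"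
proof -
  let ?C = "closed_tPS_sets G F" and ?con = "tDL_congruence G H F P"
  let ?s = "saturated_primes :: 'a rel \<Rightarrow> _" and ?c = "set_congruence :: _ \<Rightarrow> 'a rel"
  note C = saturated_primes_closed_tPS_set[OF assms]
  note con = tDL_congruence_set_congruence[OF assms]
  have cs: "?c (?s \<theta>) = \<theta>" if "?con \<theta>" for \<theta>
    using that set_congruence_saturated_primes unfolding tDL_congruence_iff by blast
  have sc: "?s (?c Y) = Y" if "Y \<in> ?C" for Y
    using that saturated_primes_set_congruence unfolding closed_tPS_sets_def by blast
  have s_Id: "?s Id = prime_filters" unfolding saturated_primes_def by simp
  have c_top: "?c prime_filters = Id"
    by (metis set_congruence_saturated_primes lattice_congruence_Id s_Id)
  \<comment> \<open>The identity corresponds to the whole space, so the bijection matches the other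
    congruences with the proper closed tPS-sets.\<close>
  have s_proper: "?s \<theta> \<in> ?C - {prime_filters}" if "?con \<theta>" "\<theta> \<noteq> Id" for \<theta>
    using that C cs c_top by (metis DiffI singletonD)
  have c_proper: "?con (?c Y) \<and> ?c Y \<noteq> Id" if "Y \<in> ?C - {prime_filters}" for Y
    using that con sc s_Id by (metis DiffE singletonI)
  show ?thesis
  proof
    assume "tDL_subdirectly_irreducible G H F P"
    then obtain \<mu> where \<mu>: "?con \<mu>" "\<mu> \<noteq> Id" "\<And>\<theta>. ?con \<theta> \<Longrightarrow> \<theta> \<noteq> Id \<Longrightarrow> \<mu> \<subseteq> \<theta>"
      unfolding tDL_subdirectly_irreducible_def by blast
    \<comment> \<open>\<open>Y\<close> is the set of saturated primes of its own congruence, which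
      lies above the monolith; passing to saturated primes reverses this inclusion.\<close>
    have "Y \<subseteq> ?s \<mu>" if Y: "Y \<in> ?C - {prime_filters}" for Y
      using saturated_primes_antimono[OF \<mu>(3)] c_proper[OF Y] sc Y by (metis DiffD1)
    then show "\<exists>Z \<in> ?C - {prime_filters}. \<forall>Y \<in> ?C - {prime_filters}. Y \<subseteq> Z"
      using s_proper[OF \<mu>(1,2)] by blast
  next
    assume "\<exists>Z \<in> ?C - {prime_filters}. \<forall>Y \<in> ?C - {prime_filters}. Y \<subseteq> Z"
    then obtain Z where Z: "Z \<in> ?C - {prime_filters}"
      and greatest: "\<And>Y. Y \<in> ?C - {prime_filters} \<Longrightarrow> Y \<subseteq> Z" by blast
    \<comment> \<open>The monolith is the congruence of \<open>Z\<close>: the saturated primes of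
      \<theta> form a proper closed tPS-set, hence lie in \<open>Z\<close>.\<close>
    have "?c Z \<subseteq> \<theta>" if "?con \<theta>" "\<theta> \<noteq> Id" for \<theta>
      using set_congruence_antimono[OF greatest[OF s_proper[OF that]]] cs[OF that(1)] by simp
    then show "tDL_subdirectly_irreducible G H F P"
      unfolding tDL_subdirectly_irreducible_def using c_proper[OF Z] by blast
  qed
qed

end
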